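(* Let $\Sigma=(\Sigma_c,\Sigma_r)$ be a structured alphabet and $\Delta$ a finite alphabet. Visibly pushdown transducers from $\Sigma$ to $\Delta$ and tail-recursive hedge-to-string transducers from $\Sigma_c\times\Sigma_r$ to $\Delta$ are equally expressive. That is: (1) for every visibly pushdown transducer $A$ from $\Sigma$ to $\Delta$ that does not accept the empty word, there exists a tail-recursive hedge-to-string transducer $T$ from $\Sigma_c\times\Sigma_r$ to $\Delta$ that does not accept the empty hedge, such that $A=T\circ\mathrm{hedge}$ (as relations between well-nested words over $\Sigma$ and words over $\Delta$); and (2) for every tail-recursive hedge-to-string transducer $T$ from $\Sigma_c\times\Sigma_r$ to $\Delta$ that does not accept the empty hedge, there exists a visibly pushdown transducer $A$ from $\Sigma$ to $\Delta$ that does not accept the empty word, such that $A=T\circ\mathrm{hedge}$.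
   Context: **Well-nested words.** A structured alphabet is a pair $\Sigma=(\Sigma_c,\Sigma_r)$ of disjoint finite alphabets (call and return symbols), identified with $\Sigma_c\cup\Sigma_r$. The set $\mathcal W_\Sigma$ of well-nested words is the least set of words over $\Sigma$ containing the empty word $\epsilon$, closed under concatenation, and such that $cwr\in\mathcal W_\Sigma$ whenever $w\in\mathcal W_\Sigma$, $c\in\Sigma_c$, $r\in\Sigma_r$. Every nonempty $w\in\mathcal W_\Sigma$ decomposes uniquely as $w=cw_1rw_2$ with $c\in\Sigma_c$, $r\in\Sigma_r$, $w_1,w_2\in\mathcal W_\Sigma$. **Hedges.** For a finite alphabet $\Lambda$, the set $\mathcal H_\Lambda$ of hedges over $\Lambda$ is the set of finite ordered sequences of unranked ordered $\Lambda$-labelled trees: a hedge is either the empty hedge $0$ or is uniquely of the form $f(h_1)\cdot h_2$ with $f\in\Lambda$ and $h_1,h_2\in\mathcal H_\Lambda$ (here $\cdot$ is associative concatenation with unit $0$). The map $\mathrm{hedge}:\mathcal W_\Sigma\to\mathcal H_{\Sigma_c\times\Sigma_r}$ is defined by $\mathrm{hedge}(\epsilon)=0$ and $\mathrm{hedge}(cw_1rw_2)=(c,r)(\mathrm{hedge}(w_1))\cdot\mathrm{hedge}(w_2)$. **Visibly pushdown transducers.** A visibly pushdown transducer from $\Sigma$ to $\Delta$ is a tuple $A=(Q,I,F,\Gamma,\delta)$ with $Q$ a finite set of states, $I,F\subseteq Q$ the initial and final states, $\Gamma$ a finite stack alphabet, $\bot\notin\Gamma$ the bottom stack symbol, and $\delta=\delta_c\uplus\delta_r$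 finite, where $\delta_c\subseteq Q\times\Sigma_c\times\Gamma\times\Delta^*\times Q$ (call transitions) and $\delta_r\subseteq Q\times\Sigma_r\times\Gamma\times\Delta^*\times Q$ (return transitions). A configuration is a pair $(q,\sigma)$ with $q\in Q$, $\sigma\in\bot\Gamma^*$. A call transition $(q,a,\gamma,v,q')$ reads $a$, outputs $v$, and goes from $(q,\sigma)$ to $(q',\sigma\gamma)$; a return transition $(q,a,\gamma,v,q')$ reads $a$, outputs $v$, and goes from $(q,\sigma\gamma)$ to $(q',\sigma)$. A run on a word is a sequence of transitions reading its letters in order; its output is the concatenation of the outputs of its transitions ($\epsilon$ for the empty run). A run is accepting if it goes from some $(q,\bot)$ with $q\in I$ to some $(q',\bot)$ with $q'\in F$. $A$ is identified with the relation of pairs $(u,v)$ such that there is an accepting run on $u$ with output $v$; this relation is included in $\mathcal W_\Sigma\times\Delta^*$. **Hedge-to-string transducers.** A hedge-to-string transducer from $\Lambda$ to $\Delta$ is a tuple $T=(Q,I,\delta)$ with $Q$ a finite set of states, $I\subseteq Q$ the initial states, and $\delta$ a finite set of rules of the forms $$q(0)\to\epsilon,\qquad q(f(x_1)\cdot x_2)\to w_1q_1(x_1)w_2q_2(x_2)w_3,$$ with $q,q_1,q_2\in Q$, $f\in\Lambda$, $w_1,w_2,w_3\in\Delta^*$. Its semantics is given by maps $[\![q]\!]:\mathcal H_\Lambda\to 2^{\Delta^*}$: $[\![q]\!](0)=\{\epsilon\}$ if $q(0)\to\epsilon\in\delta$ and $\emptyset$ otherwise; $[\![q]\!](f(h)\cdot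 h')$ is the union, over all rules $q(f(x_1)\cdot x_2)\to w_1q_1(x_1)w_2q_2(x_2)w_3$ in $\delta$, of $w_1\cdot[\![q_1]\!](h)\cdot w_2\cdot[\![q_2]\!](h')\cdot w_3$. $T$ is identified with the relation $\{(h,s)\mid\exists q\in I,\ s\in[\![q]\!](h)\}$. $T$ is tail-recursive if $w_3=\epsilon$ in every rule of the second form. A transducer accepts an input if the input is related to at least one output. $T\circ\mathrm{hedge}$ denotes the relation $\{(w,s)\mid w\in\mathcal W_\Sigma,\ (\mathrm{hedge}(w),s)\in T\}$. *)

theory Defs
  imports Main
begin

definition structured_alphabet :: "'a set \<Rightarrow> 'a set \<Rightarrow> bool" where
  "structured_alphabet \<Sigma>\<^sub>c \<Sigma>\<^sub>r \<longleftrightarrow> finite \<Sigma>\<^sub>c \<and> finite \<Sigma>\<^sub>r \<and> \<Sigma>\<^sub>c \<inter> \<Sigma>\<^sub>r = {}"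

inductive_set well_nested :: "'a set \<Rightarrow> 'a set \<Rightarrow> 'a list set"
  for \<Sigma>\<^sub>c \<Sigma>\<^sub>r :: "'a set" where
  empty: "[] \<in> well_nested \<Sigma>\<^sub>c \<Sigma>\<^sub>r"
| append: "\<lbrakk>u \<in> well_nested \<Sigma>\<^sub>c \<Sigma>\<^sub>r; v \<in> well_nested \<Sigma>\<^sub>c \<Sigma>\<^sub>r\<rbrakk> \<Longrightarrow> u @ v \<in> well_nested \<Sigma>\<^sub>c \<Sigma>\<^sub>r"
| wrap: "\<lbrakk>w \<in> well_nested \<Sigma>\<^sub>c \<Sigma>\<^sub>r; c \<in> \<Sigma>\<^sub>c; r \<in> \<Sigma>\<^sub>r\<rbrakk> \<Longrightarrow> c # w @ [r] \<in> well_nested \<Sigma>\<^sub>c \<Sigma>\<^sub>r"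

datatype (labels: 'f) tree = Node 'f "'f tree list"

type_synonym 'f hedge = "'f tree list"

definition hedges :: "'f set \<Rightarrow> 'f hedge set" where
  "hedges \<Lambda> = lists {t. labels t \<subseteq> \<Lambda>}"

inductive is_hedge_of :: "'a set \<Rightarrow> 'a set \<Rightarrow> 'a list \<Rightarrow> ('a \<times> 'a) hedge \<Rightarrow> bool"
  for \<Sigma>\<^sub>c \<Sigma>\<^sub>r :: "'a set" where
  empty: "is_hedge_of \<Sigma>\<^sub>c \<Sigma>\<^sub>r [] []"
| node: "\<lbrakk>c \<in> \<Sigma>\<^sub>c; r \<in> \<Sigma>\<^sub>r; is_hedge_of \<Sigma>\<^sub>c \<Sigma>\<^sub>r w\<^sub>1 h\<^sub>1; is_hedge_of \<Sigma>\<^sub>c \<Sigma>\<^sub>r w\<^sub>2 h\<^sub>2\<rbrakk>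
    \<Longrightarrow> is_hedge_of \<Sigma>\<^sub>c \<Sigma>\<^sub>r (c # w\<^sub>1 @ r # w\<^sub>2) (Node (c, r) h\<^sub>1 # h\<^sub>2)"

text \<open>Over a structured alphabet, the relation above is the graph of a function on the well-nested
  words; its recursion equations are \<open>hedge_Nil\<close> and \<open>hedge_Cons\<close> below. The value of
  \<open>hedge\<close> on other words is unspecified and never used.\<close>

definition hedge :: "'a set \<Rightarrow> 'a set \<Rightarrow> 'a list \<Rightarrow> ('a \<times> 'a) hedge" where
  "hedge \<Sigma>\<^sub>c \<Sigma>\<^sub>r w = (THE h. is_hedge_of \<Sigma>\<^sub>c \<Sigma>\<^sub>r w h)"

lemma is_hedge_of_append:
  "is_hedge_of C R u h \<Longrightarrow> is_hedge_of C R v k \<Longrightarrow> is_hedge_of C R (u @ v) (h @ k)"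
  by (induction rule: is_hedge_of.induct) (auto intro: is_hedge_of.intros)

lemma well_nested_has_hedge:
  "w \<in> well_nested C R \<Longrightarrow> \<exists>h. is_hedge_of C R w h"
proof (induction rule: well_nested.induct)
  case (wrap w c r)
  then show ?case
    using is_hedge_of.node[OF wrap(2,3) _ is_hedge_of.empty] by fastforce
qed (auto intro: is_hedge_of.empty is_hedge_of_append)

lemma is_hedge_of_well_nested:
  "is_hedge_of C R w h \<Longrightarrow> w \<in> well_nested C R"
proof (induction rule: is_hedge_of.induct)
  case (node c r w1 h1 w2 h2)
  then show ?case
    using well_nested.append[OF well_nested.wrap[of w1 C R c r]] by fastforce
qed (rule well_nested.empty)

lemma is_hedge_of_unique_gen:
  assumes "C \<inter> R = {}"
  shows "is_hedge_of C R u h \<Longrightarrow> is_hedge_of C R v k \<Longrightarrow> u @ x = v @ y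
    \<Longrightarrow> x = [] \<or> hd x \<in> R \<Longrightarrow> y = [] \<or> hd y \<in> R \<Longrightarrow> u = v \<and> h = k \<and> x = y"
proof (induction arbitrary: v k x y rule: is_hedge_of.induct)
  case empty
  from empty(1) show ?case
    by cases (use assms empty in auto)
next
  case (node c r w1 h1 w2 h2)
  from node.prems(1) show ?case
  proof cases
    case empty
    then show ?thesis using node.prems node.hyps assms by auto
  next
    case (node c' r' w1' h1' w2' h2')
    have "w1 @ (r # w2 @ x) = w1' @ (r' # w2' @ y)" "c = c'"
      using node.prems(2) node by auto
    with node.IH(1)[OF node(5) this(1)] node.hyps node
    have 1: "w1 = w1'" "h1 = h1'" "r = r'" "w2 @ x = w2' @ y" by auto
    with node.IH(2)[OF node(6) this(4)] node.prems node \<open>c = c'\<close>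
    show ?thesis by auto
  qed
qed

lemma is_hedge_of_unique:
  "structured_alphabet C R \<Longrightarrow> is_hedge_of C R w h \<Longrightarrow> is_hedge_of C R w k \<Longrightarrow> h = k"
  using is_hedge_of_unique_gen[of C R w h w k "[]" "[]"]
  by (auto simp: structured_alphabet_def)

lemma hedge_eqI:
  "structured_alphabet C R \<Longrightarrow> is_hedge_of C R w h \<Longrightarrow> hedge C R w = h"
  unfolding hedge_def by (blast intro: is_hedge_of_unique)

lemma is_hedge_of_hedge:
  "structured_alphabet C R \<Longrightarrow> w \<in> well_nested C R \<Longrightarrow> is_hedge_of C R w (hedge C R w)"
  using well_nested_has_hedge hedge_eqI by metis

lemma hedge_Nil:
  "structured_alphabet \<Sigma>\<^sub>c \<Sigma>\<^sub>r \<Longrightarrow> hedge \<Sigma>\<^sub>c \<Sigma>\<^sub>r [] = []"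
  by (simp add: hedge_eqI is_hedge_of.empty)

lemma hedge_Cons:
  assumes "structured_alphabet \<Sigma>\<^sub>c \<Sigma>\<^sub>r" "c \<in> \<Sigma>\<^sub>c" "r \<in> \<Sigma>\<^sub>r"
    and "w\<^sub>1 \<in> well_nested \<Sigma>\<^sub>c \<Sigma>\<^sub>r" "w\<^sub>2 \<in> well_nested \<Sigma>\<^sub>c \<Sigma>\<^sub>r"
  shows "hedge \<Sigma>\<^sub>c \<Sigma>\<^sub>r (c # w\<^sub>1 @ r # w\<^sub>2)
    = Node (c, r) (hedge \<Sigma>\<^sub>c \<Sigma>\<^sub>r w\<^sub>1) # hedge \<Sigma>\<^sub>c \<Sigma>\<^sub>r w\<^sub>2"
  using assms by (intro hedge_eqI is_hedge_of.node is_hedge_of_hedge)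

lemma hedge_in_hedges:
  assumes "structured_alphabet \<Sigma>\<^sub>c \<Sigma>\<^sub>r" "w \<in> well_nested \<Sigma>\<^sub>c \<Sigma>\<^sub>r"
  shows "hedge \<Sigma>\<^sub>c \<Sigma>\<^sub>r w \<in> hedges (\<Sigma>\<^sub>c \<times> \<Sigma>\<^sub>r)"
proof -
  have "h \<in> hedges (C \<times> R)" if "is_hedge_of C R w h" for C R :: "'a set" and w h
    using that by induction (auto simp: hedges_def in_lists_conv_set)
  then show ?thesis using assms is_hedge_of_hedge by blast
qed

record ('q, 'g, 'a, 'b) vpt =
  states :: "'q set"
  initials :: "'q set"
  finals :: "'q set"
  stack_alphabet :: "'g set"
  bottom :: 'g
  calls :: "('q \<times> 'a \<times> 'g \<times> 'b list \<times> 'q) set"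
  returns :: "('q \<times> 'a \<times> 'g \<times> 'b list \<times> 'q) set"

definition is_vpt :: "'a set \<Rightarrow> 'a set \<Rightarrow> 'b set \<Rightarrow> ('q, 'g, 'a, 'b) vpt \<Rightarrow> bool" where
  "is_vpt \<Sigma>\<^sub>c \<Sigma>\<^sub>r \<Delta> A \<longleftrightarrow>
     finite (states A) \<and> initials A \<subseteq> states A \<and> finals A \<subseteq> states A \<and>
     finite (stack_alphabet A) \<and> bottom A \<notin> stack_alphabet A \<and>
     finite (calls A) \<and> finite (returns A) \<and>
     calls A \<subseteq> states A \<times> \<Sigma>\<^sub>c \<times> stack_alphabet A \<times> lists \<Delta> \<times> states A \<and>
     returns A \<subseteq> states A \<times> \<Sigma>\<^sub>r \<times> stack_alphabet A \<times> lists \<Delta> \<times> states A"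

text \<open>Stacks are written bottom first, so the top is the last element.\<close>

definition stacks :: "('q, 'g, 'a, 'b) vpt \<Rightarrow> 'g list set" where
  "stacks A = {bottom A # \<sigma> | \<sigma>. \<sigma> \<in> lists (stack_alphabet A)}"

inductive vpt_step ::
  "('q, 'g, 'a, 'b) vpt \<Rightarrow> 'q \<times> 'g list \<Rightarrow> 'a \<Rightarrow> 'b list \<Rightarrow> 'q \<times> 'g list \<Rightarrow> bool"
  for A :: "('q, 'g, 'a, 'b) vpt" where
  call: "\<lbrakk>(q, a, \<gamma>, v, q') \<in> calls A; \<sigma> \<in> stacks A\<rbrakk> \<Longrightarrow> vpt_step A (q, \<sigma>) a v (q', \<sigma> @ [\<gamma>])"
| return: "\<lbrakk>(q, a, \<gamma>, v, q') \<in> returns A; \<sigma> \<in> stacks A\<rbrakk> \<Longrightarrow> vpt_step A (q, \<sigma> @ [\<gamma>]) a v (q', \<sigma>)"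

inductive vpt_run ::
  "('q, 'g, 'a, 'b) vpt \<Rightarrow> 'q \<times> 'g list \<Rightarrow> 'a list \<Rightarrow> 'b list \<Rightarrow> 'q \<times> 'g list \<Rightarrow> bool"
  for A :: "('q, 'g, 'a, 'b) vpt" where
  empty: "vpt_run A \<kappa> [] [] \<kappa>"
| step: "\<lbrakk>vpt_step A \<kappa>\<^sub>1 a v \<kappa>\<^sub>2; vpt_run A \<kappa>\<^sub>2 u w \<kappa>\<^sub>3\<rbrakk> \<Longrightarrow> vpt_run A \<kappa>\<^sub>1 (a # u) (v @ w) \<kappa>\<^sub>3"

definition vpt_rel :: "('q, 'g, 'a, 'b) vpt \<Rightarrow> ('a list \<times> 'b list) set" where
  "vpt_rel A = {(u, v). \<exists>q\<in>initials A. \<exists>q'\<in>finals A. vpt_run A (q, [bottom A]) u v (q', [bottom A])}"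

text \<open>\<open>LeafRule q\<close> is the rule q(0) -> empty word, and \<open>NodeRule q f w\<^sub>1 q\<^sub>1 w\<^sub>2 q\<^sub>2 w\<^sub>3\<close> is the rule
  q(f(x1) . x2) -> w1 q1(x1) w2 q2(x2) w3.\<close>

datatype ('q, 'f, 'b) h2s_rule =
  LeafRule 'q
| NodeRule 'q 'f "'b list" 'q "'b list" 'q "'b list"

record ('q, 'f, 'b) h2s =
  h2s_states :: "'q set"
  h2s_initials :: "'q set"
  rules :: "('q, 'f, 'b) h2s_rule set"

definition is_h2s :: "'f set \<Rightarrow> 'b set \<Rightarrow> ('q, 'f, 'b) h2s \<Rightarrow> bool" where
  "is_h2s \<Lambda> \<Delta> T \<longleftrightarrow>
     finite (h2s_states T) \<and> h2s_initials T \<subseteq> h2s_states T \<and> finite (rules T) \<and>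
     (\<forall>q. LeafRule q \<in> rules T \<longrightarrow> q \<in> h2s_states T) \<and>
     (\<forall>q f w\<^sub>1 q\<^sub>1 w\<^sub>2 q\<^sub>2 w\<^sub>3. NodeRule q f w\<^sub>1 q\<^sub>1 w\<^sub>2 q\<^sub>2 w\<^sub>3 \<in> rules T \<longrightarrow>
        q \<in> h2s_states T \<and> q\<^sub>1 \<in> h2s_states T \<and> q\<^sub>2 \<in> h2s_states T \<and> f \<in> \<Lambda> \<and>
        w\<^sub>1 \<in> lists \<Delta> \<and> w\<^sub>2 \<in> lists \<Delta> \<and> w\<^sub>3 \<in> lists \<Delta>)"

fun h2s_sem :: "('q, 'f, 'b) h2s \<Rightarrow> 'q \<Rightarrow> 'f hedge \<Rightarrow> 'b list set" where
  "h2s_sem T q [] = (if LeafRule q \<in> rules T then {[]} else {})"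
| "h2s_sem T q (Node f h # h') =
     {w\<^sub>1 @ u @ w\<^sub>2 @ v @ w\<^sub>3 | w\<^sub>1 q\<^sub>1 w\<^sub>2 q\<^sub>2 w\<^sub>3 u v.
        NodeRule q f w\<^sub>1 q\<^sub>1 w\<^sub>2 q\<^sub>2 w\<^sub>3 \<in> rules T \<and> u \<in> h2s_sem T q\<^sub>1 h \<and> v \<in> h2s_sem T q\<^sub>2 h'}"

definition h2s_rel :: "('q, 'f, 'b) h2s \<Rightarrow> ('f hedge \<times> 'b list) set" where
  "h2s_rel T = {(h, s). \<exists>q\<in>h2s_initials T. s \<in> h2s_sem T q h}"

text \<open>The input alphabet is not a component of the transducer, but the rules restrict inputs to it.\<close>

lemma h2s_rel_subset:
  assumes "is_h2s \<Lambda> \<Delta> T"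
  shows "h2s_rel T \<subseteq> hedges \<Lambda> \<times> lists \<Delta>"
proof -
  have "h \<in> hedges \<Lambda> \<and> s \<in> lists \<Delta>" if "is_h2s \<Lambda> \<Delta> T" "s \<in> h2s_sem T q h" for s q h
    and T :: "('c, 'a, 'b) h2s"
    using that
  proof (induction T q h arbitrary: s rule: h2s_sem.induct)
    case (1 T q)
    then show ?case by (auto simp: hedges_def split: if_splits)
  next
    case (2 T q f h h')
    from 2(4) obtain w1 q1 w2 q2 w3 u v
      where s: "s = w1 @ u @ w2 @ v @ w3" "NodeRule q f w1 q1 w2 q2 w3 \<in> rules T"
        and u: "u \<in> h2s_sem T q1 h" and v: "v \<in> h2s_sem T q2 h'"
      by auto
    have "f \<in> \<Lambda>" "w1 \<in> lists \<Delta>" "w2 \<in> lists \<Delta>" "w3 \<in> lists \<Delta>"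
      using 2(3) s(2) unfolding is_h2s_def by blast+
    moreover have "h \<in> hedges \<Lambda>" "u \<in> lists \<Delta>" using 2(1)[OF 2(3) u] by auto
    moreover have "h' \<in> hedges \<Lambda>" "v \<in> lists \<Delta>" using 2(2)[OF 2(3) v] by auto
    ultimately show ?case
      using s(1) by (auto simp: hedges_def in_lists_conv_set)
  qed
  then show ?thesis
    using assms unfolding h2s_rel_def by blast
qed

definition tail_recursive :: "('q, 'f, 'b) h2s \<Rightarrow> bool" where
  "tail_recursive T \<longleftrightarrow>
     (\<forall>q f w\<^sub>1 q\<^sub>1 w\<^sub>2 q\<^sub>2 w\<^sub>3. NodeRule q f w\<^sub>1 q\<^sub>1 w\<^sub>2 q\<^sub>2 w\<^sub>3 \<in> rules T \<longrightarrow> w\<^sub>3 = [])"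

definition accepts :: "('x \<times> 'y) set \<Rightarrow> 'x \<Rightarrow> bool" where
  "accepts X x \<longleftrightarrow> (\<exists>y. (x, y) \<in> X)"

definition comp_hedge ::
  "'a set \<Rightarrow> 'a set \<Rightarrow> ('q, 'a \<times> 'a, 'b) h2s \<Rightarrow> ('a list \<times> 'b list) set" where
  "comp_hedge \<Sigma>\<^sub>c \<Sigma>\<^sub>r T =
     {(w, s). w \<in> well_nested \<Sigma>\<^sub>c \<Sigma>\<^sub>r \<and> (hedge \<Sigma>\<^sub>c \<Sigma>\<^sub>r w, s) \<in> h2s_rel T}"

end

theory Submission
  imports Defs
begin

text \<open>A run that starts and ends with the same stack and never pops below it is either empty or
  consists of a call, such a run, the matching return and such a run. A hedge-to-string transducer
  simulates it with states \<open>(p, q)\<close>, standing for the runs from \<open>p\<close> to \<open>q\<close>; as the call and the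
  return output before the second subhedge is read, no output is left for \<open>w\<^sub>3\<close>. Conversely, a tail-recursive
  rule is simulated by pushing the rule itself when the call is read: the return then
  knows which \<open>w\<^sub>2\<close> to output and in which state \<open>q\<^sub>2\<close> to continue.\<close>

section \<open>Balanced runs\<close>

text \<open>No stack occurs here: the run above a call never inspects what lies below, so it
  suffices that the call and its matching return share \<open>\<gamma>\<close>. The input words in
  the two rules have the shapes of those in \<open>is_hedge_of\<close>, which lets runs and hedges
  be built up in parallel.\<close>

inductive balanced_run ::
  "('q, 'g, 'a, 'b) vpt \<Rightarrow> 'q \<Rightarrow> 'a list \<Rightarrow> 'b list \<Rightarrow> 'q \<Rightarrow> bool"
  for A :: "('q, 'g, 'a, 'b) vpt" where
  empty: "balanced_run A p [] [] p"
| node: "\<lbrakk>(p, c, \<gamma>, v\<^sub>1, p\<^sub>1) \<in> calls A; balanced_run A p\<^sub>1 w\<^sub>1 u p\<^sub>2;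
    (p\<^sub>2, r, \<gamma>, v\<^sub>2, p\<^sub>3) \<in> returns A; balanced_run A p\<^sub>3 w\<^sub>2 v q\<rbrakk>
    \<Longrightarrow> balanced_run A p (c # w\<^sub>1 @ r # w\<^sub>2) (v\<^sub>1 @ u @ v\<^sub>2 @ v) q"

lemma calls_of_vptD:
  assumes "is_vpt \<Sigma>\<^sub>c \<Sigma>\<^sub>r \<Delta> A" "(p, c, \<gamma>, v, q) \<in> calls A"
  shows "p \<in> states A \<and> c \<in> \<Sigma>\<^sub>c \<and> \<gamma> \<in> stack_alphabet A \<and> v \<in> lists \<Delta> \<and> q \<in> states A"
  using assms unfolding is_vpt_def by blast

lemma returns_of_vptD:
  assumes "is_vpt \<Sigma>\<^sub>c \<Sigma>\<^sub>r \<Delta> A" "(p, r, \<gamma>, v, q) \<in> returns A"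
  shows "p \<in> states A \<and> r \<in> \<Sigma>\<^sub>r \<and> \<gamma> \<in> stack_alphabet A \<and> v \<in> lists \<Delta> \<and> q \<in> states A"
  using assms unfolding is_vpt_def by blast

lemma vpt_run_append:
  "vpt_run A \<kappa>\<^sub>1 u v \<kappa>\<^sub>2 \<Longrightarrow> vpt_run A \<kappa>\<^sub>2 u' v' \<kappa>\<^sub>3 \<Longrightarrow> vpt_run A \<kappa>\<^sub>1 (u @ u') (v @ v') \<kappa>\<^sub>3"
  by (induction rule: vpt_run.induct) (auto intro: vpt_run.step)

text \<open>The stack \<open>\<sigma>\<close> is arbitrary because the inner run of a
  \<open>node\<close> takes place over \<open>\<sigma> @ [\<gamma>]\<close>. Steps exist only over
  legal stacks, so the induction also has to know that \<open>\<gamma>\<close> belongs to the stack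
  alphabet.\<close>

lemma balanced_run_imp_vpt_run:
  assumes "is_vpt \<Sigma>\<^sub>c \<Sigma>\<^sub>r \<Delta> A"
  shows "balanced_run A p w v q \<Longrightarrow> \<sigma> \<in> stacks A \<Longrightarrow> vpt_run A (p, \<sigma>) w v (q, \<sigma>)"
proof (induction arbitrary: \<sigma> rule: balanced_run.induct)
  case empty
  show ?case by (rule vpt_run.empty)
next
  case (node p c \<gamma> v1 p1 w1 u p2 r v2 p3 w2 v q)
  have "\<gamma> \<in> stack_alphabet A"
    using calls_of_vptD[OF assms node.hyps(1)] by simp
  with node.prems have "\<sigma> @ [\<gamma>] \<in> stacks A"
    by (auto simp: stacks_def)
  then show ?case
    using node by (blast intro: vpt_run.step vpt_step.intros vpt_run_append)
qed

text \<open>The symbols \<open>\<gamma>s\<close> to be popped are listed top first, whereas configurations have the top last.\<close>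

fun popping_run ::
  "('q, 'g, 'a, 'b) vpt \<Rightarrow> 'g list \<Rightarrow> 'q \<Rightarrow> 'a list \<Rightarrow> 'b list \<Rightarrow> 'q \<Rightarrow> bool" where
  "popping_run A [] p w v q = balanced_run A p w v q"
| "popping_run A (\<gamma> # \<gamma>s) p w v q =
     (\<exists>w\<^sub>1 v\<^sub>1 p\<^sub>1 r v\<^sub>r p\<^sub>2 w\<^sub>2 v\<^sub>2. w = w\<^sub>1 @ r # w\<^sub>2 \<and> v = v\<^sub>1 @ v\<^sub>r @ v\<^sub>2 \<and> balanced_run A p w\<^sub>1 v\<^sub>1 p\<^sub>1 \<and>
        (p\<^sub>1, r, \<gamma>, v\<^sub>r, p\<^sub>2) \<in> returns A \<and> popping_run A \<gamma>s p\<^sub>2 w\<^sub>2 v\<^sub>2 q)"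

text \<open>If symbols remain to be popped, the new call-return block is absorbed into the balanced
  segment that precedes the first pop; otherwise the entire run is one balanced segment and the
  block goes in front of it.\<close>

lemma popping_run_node:
  assumes "(p, c, \<gamma>, v\<^sub>1, p\<^sub>1) \<in> calls A" "balanced_run A p\<^sub>1 w\<^sub>1 u p\<^sub>2"
    "(p\<^sub>2, r, \<gamma>, v\<^sub>2, p\<^sub>3) \<in> returns A" "popping_run A \<gamma>s p\<^sub>3 w\<^sub>2 v q"
  shows "popping_run A \<gamma>s p (c # w\<^sub>1 @ r # w\<^sub>2) (v\<^sub>1 @ u @ v\<^sub>2 @ v) q"
proof (cases \<gamma>s)
  case Nil
  then show ?thesis using assms by (simp add: balanced_run.node)
next
  case (Cons \<gamma>' \<gamma>s')
  with assms(4) obtain x1 y1 p4 r' vr p5 x2 y2 where *: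
    "w\<^sub>2 = x1 @ r' # x2" "v = y1 @ vr @ y2" "balanced_run A p\<^sub>3 x1 y1 p4"
    "(p4, r', \<gamma>', vr, p5) \<in> returns A" "popping_run A \<gamma>s' p5 x2 y2 q"
    by auto
  have "c # w\<^sub>1 @ r # w\<^sub>2 = (c # w\<^sub>1 @ r # x1) @ r' # x2"
    "v\<^sub>1 @ u @ v\<^sub>2 @ v = (v\<^sub>1 @ u @ v\<^sub>2 @ y1) @ vr @ y2"
    using * by auto
  with * balanced_run.node[OF assms(1-3) *(3)] Cons show ?thesis
    unfolding popping_run.simps Cons by blast
qed

text \<open>A run is peeled off from the front, so its intermediate stacks are not just the bottom
  symbol; allowing arbitrary content \<open>\<gamma>s\<close> makes the induction go through. After
  a call, the induction hypothesis for \<open>\<gamma> # \<gamma>s\<close> exhibits the matching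
  return together with the balanced run before it. A return is a pop preceded by an empty balanced
  segment.\<close>

lemma vpt_run_imp_popping_run:
  "vpt_run A \<kappa> u v \<kappa>' \<Longrightarrow> \<kappa> = (p, bottom A # rev \<gamma>s) \<Longrightarrow> \<kappa>' = (q, [bottom A])
    \<Longrightarrow> popping_run A \<gamma>s p u v q"
proof (induction arbitrary: p \<gamma>s rule: vpt_run.induct)
  case (empty \<kappa>)
  then show ?case by (simp add: balanced_run.empty)
next
  case (step \<kappa>\<^sub>1 a v \<kappa>\<^sub>2 u w \<kappa>\<^sub>3)
  from step.hyps(1) show ?case
  proof cases
    case (call p0 \<gamma> p' \<sigma>)
    then have "popping_run A (\<gamma> # \<gamma>s) p' u w q"
      using step.prems by (intro step.IH) auto
    then show ?thesis
      using call step.prems popping_run_node[of p a \<gamma> v p' A] by auto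
  next
    case (return p0 \<gamma> p' \<sigma>)
    \<comment> \<open>The stack left by a return still contains the bottom symbol, so the popped
      symbol is one of \<open>\<gamma>s\<close>, namely its head.\<close>
    from return(4) obtain \<sigma>' where "\<sigma> = bottom A # \<sigma>'"
      by (auto simp: stacks_def)
    with return step.prems have "rev \<gamma>s = \<sigma>' @ [\<gamma>]" "p0 = p" by auto
    then have \<gamma>s: "\<gamma>s = \<gamma> # rev \<sigma>'"
      by (metis rev_eq_Cons_iff rev_rev_ident)
    have "popping_run A (rev \<sigma>') p' u w q"
      using return step.prems \<open>\<sigma> = bottom A # \<sigma>'\<close> by (intro step.IH) auto
    moreover have "a # u = [] @ a # u" "v @ w = [] @ v @ w" by simp_all
    ultimately show ?thesis
      using balanced_run.empty[of A p] return(3) \<open>p0 = p\<close>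
      unfolding \<gamma>s popping_run.simps by blast
  qed
qed

lemma vpt_rel_balanced_run:
  assumes "is_vpt \<Sigma>\<^sub>c \<Sigma>\<^sub>r \<Delta> A"
  shows "(u, v) \<in> vpt_rel A \<longleftrightarrow> (\<exists>p\<in>initials A. \<exists>q\<in>finals A. balanced_run A p u v q)"
proof -
  have "[bottom A] \<in> stacks A"
    by (simp add: stacks_def)
  then have "vpt_run A (p, [bottom A]) u v (q, [bottom A]) \<longleftrightarrow> balanced_run A p u v q" for p q
    using balanced_run_imp_vpt_run[OF assms] vpt_run_imp_popping_run[of A _ u v _ p "[]" q] by auto
  then show ?thesis
    by (simp add: vpt_rel_def)
qed

section \<open>Hedge semantics of words and tail-recursive rules\<close>

text \<open>This trades the function \<open>hedge\<close>, defined by a description operator, for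
  the inductive relation \<open>is_hedge_of\<close>, on which rule induction is possible.\<close>

lemma comp_hedge_iff:
  assumes "structured_alphabet \<Sigma>\<^sub>c \<Sigma>\<^sub>r"
  shows "(w, s) \<in> comp_hedge \<Sigma>\<^sub>c \<Sigma>\<^sub>r T \<longleftrightarrow>
    (\<exists>q\<in>h2s_initials T. \<exists>h. is_hedge_of \<Sigma>\<^sub>c \<Sigma>\<^sub>r w h \<and> s \<in> h2s_sem T q h)"
proof -
  have "w \<in> well_nested \<Sigma>\<^sub>c \<Sigma>\<^sub>r \<and> P (hedge \<Sigma>\<^sub>c \<Sigma>\<^sub>r w) \<longleftrightarrow> (\<exists>h. is_hedge_of \<Sigma>\<^sub>c \<Sigma>\<^sub>r w h \<and> P h)" for P
    using is_hedge_of_hedge[OF assms] hedge_eqI[OF assms] is_hedge_of_well_nested by metis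
  from this[of "\<lambda>h. \<exists>q\<in>h2s_initials T. s \<in> h2s_sem T q h"] show ?thesis
    unfolding comp_hedge_def h2s_rel_def by auto
qed

text \<open>This carries non-acceptance of the empty input from one model to the other once the
  relations are known to be equal.\<close>

lemma accepts_comp_hedge_Nil:
  "structured_alphabet \<Sigma>\<^sub>c \<Sigma>\<^sub>r \<Longrightarrow> accepts (comp_hedge \<Sigma>\<^sub>c \<Sigma>\<^sub>r T) [] \<longleftrightarrow> accepts (h2s_rel T) []"
  by (simp add: accepts_def comp_hedge_def hedge_Nil well_nested.empty)

lemma h2s_sem_tail_recursiveI:
  assumes "NodeRule q f w\<^sub>1 q\<^sub>1 w\<^sub>2 q\<^sub>2 [] \<in> rules T" "u \<in> h2s_sem T q\<^sub>1 h" "v \<in> h2s_sem T q\<^sub>2 h'"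
  shows "w\<^sub>1 @ u @ w\<^sub>2 @ v \<in> h2s_sem T q (Node f h # h')"
proof -
  have "w\<^sub>1 @ u @ w\<^sub>2 @ v = w\<^sub>1 @ u @ w\<^sub>2 @ v @ []" by simp
  with assms show ?thesis
    unfolding h2s_sem.simps mem_Collect_eq by (intro exI conjI)
qed

section \<open>Renaming the states of a hedge-to-string transducer\<close>

text \<open>An existential statement has to name the state type of its witness, and
  \<open>nat\<close> can host any finite state set. Renaming brings transducers with other states,
  such as pairs, into this form.\<close>

definition rename_h2s :: "('q \<Rightarrow> 'p) \<Rightarrow> ('q, 'f, 'b) h2s \<Rightarrow> ('p, 'f, 'b) h2s" where
  "rename_h2s g T = \<lparr>h2s_states = g ` h2s_states T, h2s_initials = g ` h2s_initials T,
     rules = map_h2s_rule g id id ` rules T\<rparr>"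

lemma LeafRule_in_map_image:
  "LeafRule p \<in> map_h2s_rule g id id ` R \<longleftrightarrow> (\<exists>q. p = g q \<and> LeafRule q \<in> R)"
proof
  assume "LeafRule p \<in> map_h2s_rule g id id ` R"
  then obtain \<rho> where "\<rho> \<in> R" "LeafRule p = map_h2s_rule g id id \<rho>"
    by auto
  then show "\<exists>q. p = g q \<and> LeafRule q \<in> R"
    by (cases \<rho>) auto
qed force

lemma NodeRule_in_map_image:
  "NodeRule p f w\<^sub>1 p\<^sub>1 w\<^sub>2 p\<^sub>2 w\<^sub>3 \<in> map_h2s_rule g id id ` R \<longleftrightarrow>
    (\<exists>q q\<^sub>1 q\<^sub>2. p = g q \<and> p\<^sub>1 = g q\<^sub>1 \<and> p\<^sub>2 = g q\<^sub>2 \<and> NodeRule q f w\<^sub>1 q\<^sub>1 w\<^sub>2 q\<^sub>2 w\<^sub>3 \<in> R)"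
proof
  assume "NodeRule p f w\<^sub>1 p\<^sub>1 w\<^sub>2 p\<^sub>2 w\<^sub>3 \<in> map_h2s_rule g id id ` R"
  then obtain \<rho> where "\<rho> \<in> R" "NodeRule p f w\<^sub>1 p\<^sub>1 w\<^sub>2 p\<^sub>2 w\<^sub>3 = map_h2s_rule g id id \<rho>"
    by auto
  then show "\<exists>q q\<^sub>1 q\<^sub>2. p = g q \<and> p\<^sub>1 = g q\<^sub>1 \<and> p\<^sub>2 = g q\<^sub>2 \<and> NodeRule q f w\<^sub>1 q\<^sub>1 w\<^sub>2 q\<^sub>2 w\<^sub>3 \<in> R"
    by (cases \<rho>) auto
qed force

text \<open>As \<open>g\<close> is injective on the states, a renamed rule with left-hand state
  \<open>g q\<close> comes from a rule for \<open>q\<close> itself. The two states on its right-hand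
  side are again states of \<open>T\<close>, so the induction hypotheses apply to them.\<close>

lemma h2s_sem_rename_h2s:
  assumes "is_h2s \<Lambda> \<Delta> T" "inj_on g (h2s_states T)" "q \<in> h2s_states T"
  shows "h2s_sem (rename_h2s g T) (g q) h = h2s_sem T q h"
  using assms
proof (induction T q h rule: h2s_sem.induct)
  case (1 T q)
  have "q' = q" if "g q = g q'" "LeafRule q' \<in> rules T" for q'
  proof -
    have "q' \<in> h2s_states T"
      using 1(1) that(2) unfolding is_h2s_def by blast
    then show ?thesis
      using inj_onD[OF 1(2) that(1) 1(3)] by simp
  qed
  then have "LeafRule (g q) \<in> rules (rename_h2s g T) \<longleftrightarrow> LeafRule q \<in> rules T"
    unfolding rename_h2s_def h2s.simps LeafRule_in_map_image by blast
  then show ?case by simp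
next
  case (2 T q f h h')
  have rule: "NodeRule (g q) f w1 p1 w2 p2 w3 \<in> rules (rename_h2s g T) \<longleftrightarrow>
    (\<exists>q1 q2. p1 = g q1 \<and> p2 = g q2 \<and> NodeRule q f w1 q1 w2 q2 w3 \<in> rules T)" for w1 p1 w2 p2 w3
  proof -
    have "q' = q" if "g q = g q'" "NodeRule q' f w1 q1 w2 q2 w3 \<in> rules T" for q' q1 q2
    proof -
      have "q' \<in> h2s_states T"
        using 2(3) that(2) unfolding is_h2s_def by blast
      then show ?thesis
        using inj_onD[OF 2(4) that(1) 2(5)] by simp
    qed
    then show ?thesis
      unfolding rename_h2s_def h2s.simps NodeRule_in_map_image by blast
  qed
  have IH: "h2s_sem (rename_h2s g T) (g q1) h = h2s_sem T q1 h"
    "h2s_sem (rename_h2s g T) (g q2) h' = h2s_sem T q2 h'"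
    if "NodeRule q f w1 q1 w2 q2 w3 \<in> rules T" for w1 q1 w2 q2 w3
  proof -
    have "q1 \<in> h2s_states T" "q2 \<in> h2s_states T"
      using that 2(3) unfolding is_h2s_def by blast+
    then show "h2s_sem (rename_h2s g T) (g q1) h = h2s_sem T q1 h"
      "h2s_sem (rename_h2s g T) (g q2) h' = h2s_sem T q2 h'"
      using 2(1)[OF 2(3,4)] 2(2)[OF 2(3,4)] by simp_all
  qed
  show ?case
  proof (intro set_eqI iffI)
    fix v
    assume "v \<in> h2s_sem (rename_h2s g T) (g q) (Node f h # h')"
    then obtain w1 q1 w2 q2 w3 x y where *: "v = w1 @ x @ w2 @ y @ w3"
      "NodeRule q f w1 q1 w2 q2 w3 \<in> rules T"
      "x \<in> h2s_sem (rename_h2s g T) (g q1) h" "y \<in> h2s_sem (rename_h2s g T) (g q2) h'"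
      unfolding h2s_sem.simps rule by blast
    then show "v \<in> h2s_sem T q (Node f h # h')"
      unfolding h2s_sem.simps IH[OF *(2)] by blast
  next
    fix v
    assume "v \<in> h2s_sem T q (Node f h # h')"
    then obtain w1 q1 w2 q2 w3 x y where *: "v = w1 @ x @ w2 @ y @ w3"
      "NodeRule q f w1 q1 w2 q2 w3 \<in> rules T" "x \<in> h2s_sem T q1 h" "y \<in> h2s_sem T q2 h'"
      unfolding h2s_sem.simps by blast
    then show "v \<in> h2s_sem (rename_h2s g T) (g q) (Node f h # h')"
      unfolding h2s_sem.simps rule IH[OF *(2), symmetric] by blast
  qed
qed

lemma ex_nat_h2s:
  assumes "is_h2s \<Lambda> \<Delta> T" "tail_recursive T"
  obtains T' :: "(nat, 'f, 'b) h2s"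
  where "is_h2s \<Lambda> \<Delta> T'" "tail_recursive T'" "h2s_rel T' = h2s_rel T"
proof -
  have "finite (h2s_states T)"
    using assms(1) by (simp add: is_h2s_def)
  then obtain g :: "_ \<Rightarrow> nat" where g: "inj_on g (h2s_states T)"
    using finite_imp_inj_to_nat_seg by blast
  show thesis
  proof
    show "is_h2s \<Lambda> \<Delta> (rename_h2s g T)"
      using assms(1) unfolding is_h2s_def rename_h2s_def h2s.simps LeafRule_in_map_image
        NodeRule_in_map_image by blast
    show "tail_recursive (rename_h2s g T)"
      using assms(2) by (auto simp: tail_recursive_def rename_h2s_def NodeRule_in_map_image)
    have "h2s_initials T \<subseteq> h2s_states T"
      using assms(1) by (simp add: is_h2s_def)
    moreover have "h2s_initials (rename_h2s g T) = g ` h2s_initials T"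
      by (simp add: rename_h2s_def)
    ultimately show "h2s_rel (rename_h2s g T) = h2s_rel T"
      using h2s_sem_rename_h2s[OF assms(1) g] by (auto simp: h2s_rel_def subset_iff)
  qed
qed

section \<open>From visibly pushdown to hedge-to-string transducers\<close>

text \<open>A rule guesses the state \<open>p\<^sub>2\<close> in which the inner run ends and hands
  the target \<open>q\<close> on to the rest. The stack symbol is forgotten after it has matched a
  call with a return. Leaf rules are diagonal because an empty run does not change the
  state.\<close>

inductive_set rules_of_vpt ::
  "('q, 'g, 'a, 'b) vpt \<Rightarrow> ('q \<times> 'q, 'a \<times> 'a, 'b) h2s_rule set"
  for A :: "('q, 'g, 'a, 'b) vpt" where
  leaf: "q \<in> states A \<Longrightarrow> LeafRule (q, q) \<in> rules_of_vpt A"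
| node: "\<lbrakk>(p, c, \<gamma>, v\<^sub>1, p\<^sub>1) \<in> calls A; (p\<^sub>2, r, \<gamma>, v\<^sub>2, p\<^sub>3) \<in> returns A; q \<in> states A\<rbrakk>
    \<Longrightarrow> NodeRule (p, q) (c, r) v\<^sub>1 (p\<^sub>1, p\<^sub>2) v\<^sub>2 (p\<^sub>3, q) [] \<in> rules_of_vpt A"

inductive_cases LeafRule_of_vptE: "LeafRule s \<in> rules_of_vpt A"
inductive_cases NodeRule_of_vptE: "NodeRule s f w\<^sub>1 s\<^sub>1 w\<^sub>2 s\<^sub>2 w\<^sub>3 \<in> rules_of_vpt A"

definition h2s_of_vpt :: "('q, 'g, 'a, 'b) vpt \<Rightarrow> ('q \<times> 'q, 'a \<times> 'a, 'b) h2s" where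
  "h2s_of_vpt A = \<lparr>h2s_states = states A \<times> states A, h2s_initials = initials A \<times> finals A,
     rules = rules_of_vpt A\<rparr>"

lemma h2s_of_vpt_simps [simp]:
  "h2s_states (h2s_of_vpt A) = states A \<times> states A"
  "h2s_initials (h2s_of_vpt A) = initials A \<times> finals A"
  "rules (h2s_of_vpt A) = rules_of_vpt A"
  by (simp_all add: h2s_of_vpt_def)

lemma finite_rules_of_vpt:
  assumes "is_vpt \<Sigma>\<^sub>c \<Sigma>\<^sub>r \<Delta> A"
  shows "finite (rules_of_vpt A)"
proof (rule finite_subset)
  \<comment> \<open>The map ignores whether \<open>\<gamma>\<close> and \<open>\<gamma>'\<close>
    agree; for finiteness a superset of the rules is enough.\<close>
  let ?node = "\<lambda>((p, c, \<gamma>, v\<^sub>1, p\<^sub>1), (p\<^sub>2, r, \<gamma>', v\<^sub>2, p\<^sub>3), q).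
    NodeRule (p, q) (c, r) v\<^sub>1 (p\<^sub>1, p\<^sub>2) v\<^sub>2 (p\<^sub>3, q) []"
  show "rules_of_vpt A \<subseteq> (\<lambda>q. LeafRule (q, q)) ` states A \<union> ?node ` (calls A \<times> returns A \<times> states A)"
  proof
    fix \<rho>
    assume "\<rho> \<in> rules_of_vpt A"
    then show "\<rho> \<in> (\<lambda>q. LeafRule (q, q)) ` states A \<union> ?node ` (calls A \<times> returns A \<times> states A)"
    proof cases
      case (leaf q)
      then show ?thesis by (intro UnI1 image_eqI)
    next
      case (node p c \<gamma> v1 p1 p2 r v2 p3 q)
      then have "\<rho> = ?node ((p, c, \<gamma>, v1, p1), (p2, r, \<gamma>, v2, p3), q)" by simp
      with node(2-4) show ?thesis
        by (intro UnI2 image_eqI[of _ ?node "((p, c, \<gamma>, v1, p1), (p2, r, \<gamma>, v2, p3), q)"] SigmaI)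
    qed
  qed
  show "finite ((\<lambda>q. LeafRule (q, q)) ` states A \<union> ?node ` (calls A \<times> returns A \<times> states A))"
    by (intro finite_UnI finite_imageI finite_cartesian_product)
      (use assms in \<open>simp_all add: is_vpt_def\<close>)
qed

lemma is_h2s_h2s_of_vpt:
  assumes "is_vpt \<Sigma>\<^sub>c \<Sigma>\<^sub>r \<Delta> A"
  shows "is_h2s (\<Sigma>\<^sub>c \<times> \<Sigma>\<^sub>r) \<Delta> (h2s_of_vpt A)"
proof -
  have "s \<in> states A \<times> states A \<and> s\<^sub>1 \<in> states A \<times> states A \<and> s\<^sub>2 \<in> states A \<times> states A \<and>
      f \<in> \<Sigma>\<^sub>c \<times> \<Sigma>\<^sub>r \<and> w\<^sub>1 \<in> lists \<Delta> \<and> w\<^sub>2 \<in> lists \<Delta> \<and> w\<^sub>3 \<in> lists \<Delta>"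
    if "NodeRule s f w\<^sub>1 s\<^sub>1 w\<^sub>2 s\<^sub>2 w\<^sub>3 \<in> rules_of_vpt A" for s f w\<^sub>1 s\<^sub>1 w\<^sub>2 s\<^sub>2 w\<^sub>3
    using that
  proof cases
    case (node p c \<gamma> p\<^sub>1 p\<^sub>2 r p\<^sub>3 q)
    then show ?thesis
      using calls_of_vptD[OF assms node(6)] returns_of_vptD[OF assms node(7)] by simp
  qed
  moreover have "s \<in> states A \<times> states A" if "LeafRule s \<in> rules_of_vpt A" for s
    using that by cases simp
  moreover have "initials A \<times> finals A \<subseteq> states A \<times> states A" "finite (states A \<times> states A)"
    using assms unfolding is_vpt_def by blast+
  ultimately show ?thesis
    using finite_rules_of_vpt[OF assms] unfolding is_h2s_def h2s_of_vpt_simps by blast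
qed

lemma tail_recursive_h2s_of_vpt: "tail_recursive (h2s_of_vpt A)"
  unfolding tail_recursive_def h2s_of_vpt_simps by (blast elim: NodeRule_of_vptE)

text \<open>An empty balanced run exists at any \<open>p\<close> whatsoever, while leaf rules exist
  only for states; hence the premise on \<open>q\<close>. For the inner run it holds because a
  return transition starts at \<open>p2\<close>.\<close>

lemma balanced_run_imp_h2s_of_vpt:
  assumes "is_vpt \<Sigma>\<^sub>c \<Sigma>\<^sub>r \<Delta> A"
  shows "balanced_run A p w v q \<Longrightarrow> q \<in> states A
    \<Longrightarrow> \<exists>h. is_hedge_of \<Sigma>\<^sub>c \<Sigma>\<^sub>r w h \<and> v \<in> h2s_sem (h2s_of_vpt A) (p, q) h"
proof (induction rule: balanced_run.induct)
  case (empty p)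
  then have "[] \<in> h2s_sem (h2s_of_vpt A) (p, p) []"
    by (simp add: rules_of_vpt.leaf)
  with is_hedge_of.empty show ?case by blast
next
  case (node p c \<gamma> v1 p1 w1 u p2 r v2 p3 w2 v q)
  have mem: "c \<in> \<Sigma>\<^sub>c" "r \<in> \<Sigma>\<^sub>r" "p2 \<in> states A"
    using calls_of_vptD[OF assms node.hyps(1)] returns_of_vptD[OF assms node.hyps(3)] by simp_all
  from node.IH(1)[OF mem(3)] node.IH(2)[OF node.prems] obtain h1 h2 where
    h: "is_hedge_of \<Sigma>\<^sub>c \<Sigma>\<^sub>r w1 h1" "u \<in> h2s_sem (h2s_of_vpt A) (p1, p2) h1"
    "is_hedge_of \<Sigma>\<^sub>c \<Sigma>\<^sub>r w2 h2" "v \<in> h2s_sem (h2s_of_vpt A) (p3, q) h2"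
    by (elim exE conjE)
  have "NodeRule (p, q) (c, r) v1 (p1, p2) v2 (p3, q) [] \<in> rules (h2s_of_vpt A)"
    unfolding h2s_of_vpt_simps by (rule rules_of_vpt.node[OF node.hyps(1,3) node.prems])
  from h2s_sem_tail_recursiveI[OF this h(2,4)] is_hedge_of.node[OF mem(1,2) h(1,3)]
  show ?case by (intro exI[of _ "Node (c, r) h1 # h2"] conjI)
qed

lemma h2s_of_vpt_imp_balanced_run:
  "is_hedge_of \<Sigma>\<^sub>c \<Sigma>\<^sub>r w h \<Longrightarrow> v \<in> h2s_sem (h2s_of_vpt A) (p, q) h \<Longrightarrow> balanced_run A p w v q"
proof (induction arbitrary: p q v rule: is_hedge_of.induct)
  case empty
  then have "LeafRule (p, q) \<in> rules_of_vpt A" "v = []"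
    by (auto split: if_splits)
  then show ?case
    by (auto intro: balanced_run.empty elim: LeafRule_of_vptE)
next
  case (node c r w1 h1 w2 h2)
  from node.prems obtain v1 s1 v2 s2 v3 x y where v: "v = v1 @ x @ v2 @ y @ v3"
    and x: "x \<in> h2s_sem (h2s_of_vpt A) s1 h1" and y: "y \<in> h2s_sem (h2s_of_vpt A) s2 h2"
    and rule: "NodeRule (p, q) (c, r) v1 s1 v2 s2 v3 \<in> rules_of_vpt A"
    unfolding h2s_sem.simps h2s_of_vpt_simps by blast
  from rule obtain \<gamma> p1 p2 p3 where "s1 = (p1, p2)" "s2 = (p3, q)" "v3 = []"
    "(p, c, \<gamma>, v1, p1) \<in> calls A" "(p2, r, \<gamma>, v2, p3) \<in> returns A"
    by cases
  with v x y balanced_run.node[of p c \<gamma> v1 p1 A w1 x p2 r v2 p3 w2 y q] node.IH show ?case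
    by simp
qed

lemma vpt_rel_eq_comp_hedge_h2s_of_vpt:
  assumes "structured_alphabet \<Sigma>\<^sub>c \<Sigma>\<^sub>r" "is_vpt \<Sigma>\<^sub>c \<Sigma>\<^sub>r \<Delta> A"
  shows "vpt_rel A = comp_hedge \<Sigma>\<^sub>c \<Sigma>\<^sub>r (h2s_of_vpt A)"
proof -
  have "finals A \<subseteq> states A"
    using assms(2) by (simp add: is_vpt_def)
  moreover have "balanced_run A p w v q \<longleftrightarrow>
    (\<exists>h. is_hedge_of \<Sigma>\<^sub>c \<Sigma>\<^sub>r w h \<and> v \<in> h2s_sem (h2s_of_vpt A) (p, q) h)" if "q \<in> states A" for p q w v
    using balanced_run_imp_h2s_of_vpt[OF assms(2) _ that, of p w v]
      h2s_of_vpt_imp_balanced_run[of \<Sigma>\<^sub>c \<Sigma>\<^sub>r w _ v A p q] by blast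
  ultimately have "(w, v) \<in> vpt_rel A \<longleftrightarrow> (w, v) \<in> comp_hedge \<Sigma>\<^sub>c \<Sigma>\<^sub>r (h2s_of_vpt A)" for w v
    unfolding vpt_rel_balanced_run[OF assms(2)] comp_hedge_iff[OF assms(1)] h2s_of_vpt_simps
    by blast
  then show ?thesis by auto
qed

section \<open>From hedge-to-string to visibly pushdown transducers\<close>

text \<open>The stack symbols are the codes \<open>Suc (g \<rho>)\<close> of the rules \<open>\<rho>\<close>, so that \<open>0\<close> is free for the bottom.\<close>

inductive_set calls_of_h2s ::
  "(('q, 'a \<times> 'a, 'b) h2s_rule \<Rightarrow> nat) \<Rightarrow> ('q, 'a \<times> 'a, 'b) h2s \<Rightarrow>
    ('q \<times> 'a \<times> nat \<times> 'b list \<times> 'q) set"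
  for g :: "('q, 'a \<times> 'a, 'b) h2s_rule \<Rightarrow> nat" and T :: "('q, 'a \<times> 'a, 'b) h2s" where
  call: "\<lbrakk>\<rho> \<in> rules T; \<rho> = NodeRule q (c, r) w\<^sub>1 q\<^sub>1 w\<^sub>2 q\<^sub>2 w\<^sub>3\<rbrakk>
    \<Longrightarrow> (q, c, Suc (g \<rho>), w\<^sub>1, q\<^sub>1) \<in> calls_of_h2s g T"

text \<open>The return may start in any state \<open>p\<close> with a leaf rule: this is the check
  that the first subhedge has been processed to its end. Everything else is dictated by the popped
  rule, including the return symbol, which was guessed at the call.\<close>

inductive_set returns_of_h2s ::
  "(('q, 'a \<times> 'a, 'b) h2s_rule \<Rightarrow> nat) \<Rightarrow> ('q, 'a \<times> 'a, 'b) h2s \<Rightarrow>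
    ('q \<times> 'a \<times> nat \<times> 'b list \<times> 'q) set"
  for g :: "('q, 'a \<times> 'a, 'b) h2s_rule \<Rightarrow> nat" and T :: "('q, 'a \<times> 'a, 'b) h2s" where
  return: "\<lbrakk>\<rho> \<in> rules T; \<rho> = NodeRule q (c, r) w\<^sub>1 q\<^sub>1 w\<^sub>2 q\<^sub>2 w\<^sub>3; LeafRule p \<in> rules T\<rbrakk>
    \<Longrightarrow> (p, r, Suc (g \<rho>), w\<^sub>2, q\<^sub>2) \<in> returns_of_h2s g T"

lemma calls_of_h2sE:
  assumes "t \<in> calls_of_h2s g T"
  obtains (call) \<rho> q c r w\<^sub>1 q\<^sub>1 w\<^sub>2 q\<^sub>2 w\<^sub>3 where "t = (q, c, Suc (g \<rho>), w\<^sub>1, q\<^sub>1)" "\<rho> \<in> rules T"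
    "\<rho> = NodeRule q (c, r) w\<^sub>1 q\<^sub>1 w\<^sub>2 q\<^sub>2 w\<^sub>3"
proof -
  obtain q c \<gamma> w\<^sub>1 q\<^sub>1 where t: "t = (q, c, \<gamma>, w\<^sub>1, q\<^sub>1)" by (cases t)
  from assms[unfolded t] show thesis
    by cases (rule that, simp_all add: t)
qed

lemma returns_of_h2sE:
  assumes "t \<in> returns_of_h2s g T"
  obtains (return) \<rho> q c r w\<^sub>1 q\<^sub>1 w\<^sub>2 q\<^sub>2 w\<^sub>3 p where "t = (p, r, Suc (g \<rho>), w\<^sub>2, q\<^sub>2)" "\<rho> \<in> rules T"
    "\<rho> = NodeRule q (c, r) w\<^sub>1 q\<^sub>1 w\<^sub>2 q\<^sub>2 w\<^sub>3" "LeafRule p \<in> rules T"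
proof -
  obtain p r \<gamma> w\<^sub>2 q\<^sub>2 where t: "t = (p, r, \<gamma>, w\<^sub>2, q\<^sub>2)" by (cases t)
  from assms[unfolded t] show thesis
    by cases (rule that, simp_all add: t)
qed

text \<open>The final states close the outermost hedge by a leaf rule, just as the sources of the
  return transitions close the inner ones.\<close>

definition vpt_of_h2s ::
  "(('q, 'a \<times> 'a, 'b) h2s_rule \<Rightarrow> nat) \<Rightarrow> ('q, 'a \<times> 'a, 'b) h2s \<Rightarrow> ('q, nat, 'a, 'b) vpt" where
  "vpt_of_h2s g T = \<lparr>states = h2s_states T, initials = h2s_initials T,
     finals = {q. LeafRule q \<in> rules T}, stack_alphabet = (\<lambda>\<rho>. Suc (g \<rho>)) ` rules T, bottom = 0,
     calls = calls_of_h2s g T, returns = returns_of_h2s g T\<rparr>"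

lemma vpt_of_h2s_simps [simp]:
  "states (vpt_of_h2s g T) = h2s_states T"
  "initials (vpt_of_h2s g T) = h2s_initials T"
  "finals (vpt_of_h2s g T) = {q. LeafRule q \<in> rules T}"
  "stack_alphabet (vpt_of_h2s g T) = (\<lambda>\<rho>. Suc (g \<rho>)) ` rules T"
  "bottom (vpt_of_h2s g T) = 0"
  "calls (vpt_of_h2s g T) = calls_of_h2s g T"
  "returns (vpt_of_h2s g T) = returns_of_h2s g T"
  by (simp_all add: vpt_of_h2s_def)

lemma finite_calls_of_h2s:
  assumes "finite (rules T)"
  shows "finite (calls_of_h2s g T)"
proof (rule finite_subset)
  \<comment> \<open>On leaf rules this map is \<open>undefined\<close>, which merely adds one
    element to the finite superset.\<close>
  let ?call = "\<lambda>\<rho>. case \<rho> of NodeRule q f w\<^sub>1 q\<^sub>1 w\<^sub>2 q\<^sub>2 w\<^sub>3 \<Rightarrow> (q, fst f, Suc (g \<rho>), w\<^sub>1, q\<^sub>1)"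
  show "calls_of_h2s g T \<subseteq> ?call ` rules T"
  proof
    fix t
    assume "t \<in> calls_of_h2s g T"
    then show "t \<in> ?call ` rules T"
    proof (cases rule: calls_of_h2sE)
      case (call \<rho> q c r w\<^sub>1 q\<^sub>1 w\<^sub>2 q\<^sub>2 w\<^sub>3)
      then have "t = ?call \<rho>" by simp
      then show ?thesis using call(2) by (rule image_eqI)
    qed
  qed
  show "finite (?call ` rules T)"
    using assms by (rule finite_imageI)
qed

lemma finite_returns_of_h2s:
  assumes "is_h2s \<Lambda> \<Delta> T"
  shows "finite (returns_of_h2s g T)"
proof (rule finite_subset)
  let ?return = "\<lambda>(p, \<rho>). case \<rho> of NodeRule q f w\<^sub>1 q\<^sub>1 w\<^sub>2 q\<^sub>2 w\<^sub>3 \<Rightarrow> (p, snd f, Suc (g \<rho>), w\<^sub>2, q\<^sub>2)"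
  show "returns_of_h2s g T \<subseteq> ?return ` (h2s_states T \<times> rules T)"
  proof
    fix t
    assume "t \<in> returns_of_h2s g T"
    then show "t \<in> ?return ` (h2s_states T \<times> rules T)"
    proof (cases rule: returns_of_h2sE)
      case (return \<rho> q c r w\<^sub>1 q\<^sub>1 w\<^sub>2 q\<^sub>2 w\<^sub>3 p)
      then have "t = ?return (p, \<rho>)" by simp
      moreover have "p \<in> h2s_states T"
        using assms return(4) unfolding is_h2s_def by blast
      ultimately show ?thesis
        using return(2) by (intro image_eqI[of _ ?return "(p, \<rho>)"] SigmaI)
    qed
  qed
  show "finite (?return ` (h2s_states T \<times> rules T))"
    by (intro finite_imageI finite_cartesian_product) (use assms in \<open>simp_all add: is_h2s_def\<close>)
qed

lemma NodeRuleD: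
  assumes "is_h2s \<Lambda> \<Delta> T" "NodeRule q f w\<^sub>1 q\<^sub>1 w\<^sub>2 q\<^sub>2 w\<^sub>3 \<in> rules T"
  shows "q \<in> h2s_states T \<and> q\<^sub>1 \<in> h2s_states T \<and> q\<^sub>2 \<in> h2s_states T \<and> f \<in> \<Lambda> \<and>
    w\<^sub>1 \<in> lists \<Delta> \<and> w\<^sub>2 \<in> lists \<Delta> \<and> w\<^sub>3 \<in> lists \<Delta>"
  using assms unfolding is_h2s_def by blast

lemma LeafRuleD: "is_h2s \<Lambda> \<Delta> T \<Longrightarrow> LeafRule q \<in> rules T \<Longrightarrow> q \<in> h2s_states T"
  unfolding is_h2s_def by blast

lemma is_vpt_vpt_of_h2s:
  assumes "is_h2s (\<Sigma>\<^sub>c \<times> \<Sigma>\<^sub>r) \<Delta> T"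
  shows "is_vpt \<Sigma>\<^sub>c \<Sigma>\<^sub>r \<Delta> (vpt_of_h2s g T)"
proof -
  have fin: "finite (rules T)" "finite (h2s_states T)" "h2s_initials T \<subseteq> h2s_states T"
    using assms by (auto simp: is_h2s_def)
  have "calls_of_h2s g T \<subseteq>
    h2s_states T \<times> \<Sigma>\<^sub>c \<times> (\<lambda>\<rho>. Suc (g \<rho>)) ` rules T \<times> lists \<Delta> \<times> h2s_states T"
  proof
    fix t
    assume "t \<in> calls_of_h2s g T"
    then show "t \<in> h2s_states T \<times> \<Sigma>\<^sub>c \<times> (\<lambda>\<rho>. Suc (g \<rho>)) ` rules T \<times> lists \<Delta> \<times> h2s_states T"
    proof (cases rule: calls_of_h2sE)
      case (call \<rho> q c r w\<^sub>1 q\<^sub>1 w\<^sub>2 q\<^sub>2 w\<^sub>3)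
      then show ?thesis
        using NodeRuleD[OF assms, of q "(c, r)" w\<^sub>1 q\<^sub>1 w\<^sub>2 q\<^sub>2 w\<^sub>3] by simp
    qed
  qed
  moreover have "returns_of_h2s g T \<subseteq>
    h2s_states T \<times> \<Sigma>\<^sub>r \<times> (\<lambda>\<rho>. Suc (g \<rho>)) ` rules T \<times> lists \<Delta> \<times> h2s_states T"
  proof
    fix t
    assume "t \<in> returns_of_h2s g T"
    then show "t \<in> h2s_states T \<times> \<Sigma>\<^sub>r \<times> (\<lambda>\<rho>. Suc (g \<rho>)) ` rules T \<times> lists \<Delta> \<times> h2s_states T"
    proof (cases rule: returns_of_h2sE)
      case (return \<rho> q c r w\<^sub>1 q\<^sub>1 w\<^sub>2 q\<^sub>2 w\<^sub>3 p)
      then show ?thesis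
        using NodeRuleD[OF assms, of q "(c, r)" w\<^sub>1 q\<^sub>1 w\<^sub>2 q\<^sub>2 w\<^sub>3] LeafRuleD[OF assms return(4)] by simp
    qed
  qed
  moreover have "{q. LeafRule q \<in> rules T} \<subseteq> h2s_states T"
    using LeafRuleD[OF assms] by blast
  ultimately show ?thesis
    using fin finite_calls_of_h2s[OF fin(1)] finite_returns_of_h2s[OF assms]
    unfolding is_vpt_def vpt_of_h2s_simps by blast
qed

text \<open>The premise that the run ends in a state with a leaf rule passes to the inner run, since
  a return can be taken only from such a state.\<close>

lemma balanced_run_vpt_of_h2s_imp_h2s:
  assumes "is_h2s (\<Sigma>\<^sub>c \<times> \<Sigma>\<^sub>r) \<Delta> T" "tail_recursive T" "inj_on g (rules T)"
  shows "balanced_run (vpt_of_h2s g T) q w v q' \<Longrightarrow> LeafRule q' \<in> rules T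
    \<Longrightarrow> \<exists>h. is_hedge_of \<Sigma>\<^sub>c \<Sigma>\<^sub>r w h \<and> v \<in> h2s_sem T q h"
proof (induction rule: balanced_run.induct)
  case (empty p)
  then have "[] \<in> h2s_sem T p []" by simp
  with is_hedge_of.empty show ?case by blast
next
  case (node q c \<gamma> v1 q1 w1 u p r v2 q2 w2 v q')
  from node.hyps(1)[unfolded vpt_of_h2s_simps] obtain \<rho> r' x2 y2 z2 where
    \<rho>: "\<rho> \<in> rules T" "\<rho> = NodeRule q (c, r') v1 q1 x2 y2 z2" "\<gamma> = Suc (g \<rho>)"
    by cases
  from node.hyps(3)[unfolded vpt_of_h2s_simps] obtain \<rho>' q0 c' x1 y1 z1 where
    \<rho>': "\<rho>' \<in> rules T" "\<rho>' = NodeRule q0 (c', r) x1 y1 v2 q2 z1" "\<gamma> = Suc (g \<rho>')"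
    and p: "LeafRule p \<in> rules T"
    by cases
  \<comment> \<open>Call and return agree on the stack symbol, so injectivity of the coding shows
    that both come from one rule. Its call half supplies \<open>c\<close>, \<open>v1\<close>,
    \<open>q1\<close>, and its return half \<open>r\<close>, \<open>v2\<close>,
    \<open>q2\<close>.\<close>
  have "\<rho> = \<rho>'"
    using inj_onD[OF assms(3) _ \<rho>(1) \<rho>'(1)] \<rho>(3) \<rho>'(3) by simp
  moreover have "z2 = []"
    using assms(2) \<rho>(1) unfolding \<rho>(2) tail_recursive_def by blast
  ultimately have rule: "NodeRule q (c, r) v1 q1 v2 q2 [] \<in> rules T"
    using \<rho>(1,2) \<rho>'(2) by simp
  have mem: "c \<in> \<Sigma>\<^sub>c" "r \<in> \<Sigma>\<^sub>r"
    using NodeRuleD[OF assms(1) rule] by simp_all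
  from node.IH(1)[OF p] node.IH(2)[OF node.prems] obtain h1 h2 where
    h: "is_hedge_of \<Sigma>\<^sub>c \<Sigma>\<^sub>r w1 h1" "u \<in> h2s_sem T q1 h1"
    "is_hedge_of \<Sigma>\<^sub>c \<Sigma>\<^sub>r w2 h2" "v \<in> h2s_sem T q2 h2"
    by (elim exE conjE)
  from h2s_sem_tail_recursiveI[OF rule h(2,4)] is_hedge_of.node[OF mem h(1,3)]
  show ?case by (intro exI[of _ "Node (c, r) h1 # h2"] conjI)
qed

text \<open>The end state is existential because it depends on the derivation: it is where the leaf
  rule is applied at the end of the top-level sequence. Tail recursion enters since, after the run
  on the second subhedge, no transition remains that could output \<open>w\<^sub>3\<close>.\<close>

lemma h2s_imp_balanced_run_vpt_of_h2s:
  assumes "tail_recursive T"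
  shows "is_hedge_of \<Sigma>\<^sub>c \<Sigma>\<^sub>r w h \<Longrightarrow> v \<in> h2s_sem T q h
    \<Longrightarrow> \<exists>q'. balanced_run (vpt_of_h2s g T) q w v q' \<and> LeafRule q' \<in> rules T"
proof (induction arbitrary: q v rule: is_hedge_of.induct)
  case empty
  then show ?case
    by (auto intro: balanced_run.empty split: if_splits)
next
  case (node c r w1 h1 w2 h2)
  from node.prems obtain v1 q1 v2 q2 v3 x y where rule: "NodeRule q (c, r) v1 q1 v2 q2 v3 \<in> rules T"
    and v: "v = v1 @ x @ v2 @ y @ v3" and x: "x \<in> h2s_sem T q1 h1" and y: "y \<in> h2s_sem T q2 h2"
    unfolding h2s_sem.simps by blast
  have v3: "v3 = []"
    using rule assms unfolding tail_recursive_def by blast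
  from node.IH(1)[OF x] node.IH(2)[OF y] obtain p q' where
    p: "balanced_run (vpt_of_h2s g T) q1 w1 x p" "LeafRule p \<in> rules T" and
    q': "balanced_run (vpt_of_h2s g T) q2 w2 y q'" "LeafRule q' \<in> rules T"
    by (elim exE conjE)
  let ?\<gamma> = "Suc (g (NodeRule q (c, r) v1 q1 v2 q2 v3))"
  have "(q, c, ?\<gamma>, v1, q1) \<in> calls (vpt_of_h2s g T)" "(p, r, ?\<gamma>, v2, q2) \<in> returns (vpt_of_h2s g T)"
    unfolding vpt_of_h2s_simps
    using calls_of_h2s.call[OF rule refl] returns_of_h2s.return[OF rule refl p(2)] .
  from balanced_run.node[OF this(1) p(1) this(2) q'(1)] show ?case
    using q'(2) v v3 by (intro exI[of _ q']) simp
qed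

lemma vpt_rel_vpt_of_h2s:
  assumes "structured_alphabet \<Sigma>\<^sub>c \<Sigma>\<^sub>r" "is_h2s (\<Sigma>\<^sub>c \<times> \<Sigma>\<^sub>r) \<Delta> T" "tail_recursive T"
    "inj_on g (rules T)"
  shows "vpt_rel (vpt_of_h2s g T) = comp_hedge \<Sigma>\<^sub>c \<Sigma>\<^sub>r T"
proof -
  have "(\<exists>q'. balanced_run (vpt_of_h2s g T) q w v q' \<and> LeafRule q' \<in> rules T) \<longleftrightarrow>
    (\<exists>h. is_hedge_of \<Sigma>\<^sub>c \<Sigma>\<^sub>r w h \<and> v \<in> h2s_sem T q h)" for q w v
    using balanced_run_vpt_of_h2s_imp_h2s[OF assms(2-4), of q w v]
      h2s_imp_balanced_run_vpt_of_h2s[OF assms(3), of \<Sigma>\<^sub>c \<Sigma>\<^sub>r w _ v q g] by blast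
  then have "(w, v) \<in> vpt_rel (vpt_of_h2s g T) \<longleftrightarrow> (w, v) \<in> comp_hedge \<Sigma>\<^sub>c \<Sigma>\<^sub>r T" for w v
    unfolding vpt_rel_balanced_run[OF is_vpt_vpt_of_h2s[OF assms(2)]] comp_hedge_iff[OF assms(1)]
      vpt_of_h2s_simps by blast
  then show ?thesis by auto
qed

section \<open>Both translations with states in \<open>nat\<close>\<close>

theorem lemma3:
  fixes \<Sigma>\<^sub>c \<Sigma>\<^sub>r :: "'a set" and \<Delta> :: "'b set"
  assumes "structured_alphabet \<Sigma>\<^sub>c \<Sigma>\<^sub>r" and "finite \<Delta>"
  shows "(\<forall>A :: ('q, 'g, 'a, 'b) vpt.
            is_vpt \<Sigma>\<^sub>c \<Sigma>\<^sub>r \<Delta> A \<and> \<not> accepts (vpt_rel A) [] \<longrightarrow>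
            (\<exists>T :: (nat, 'a \<times> 'a, 'b) h2s.
               is_h2s (\<Sigma>\<^sub>c \<times> \<Sigma>\<^sub>r) \<Delta> T \<and> tail_recursive T \<and> \<not> accepts (h2s_rel T) [] \<and>
               vpt_rel A = comp_hedge \<Sigma>\<^sub>c \<Sigma>\<^sub>r T)) \<and>
         (\<forall>T :: ('p, 'a \<times> 'a, 'b) h2s.
            is_h2s (\<Sigma>\<^sub>c \<times> \<Sigma>\<^sub>r) \<Delta> T \<and> tail_recursive T \<and> \<not> accepts (h2s_rel T) [] \<longrightarrow>
            (\<exists>A :: (nat, nat, 'a, 'b) vpt.
               is_vpt \<Sigma>\<^sub>c \<Sigma>\<^sub>r \<Delta> A \<and> \<not> accepts (vpt_rel A) [] \<and>
               vpt_rel A = comp_hedge \<Sigma>\<^sub>c \<Sigma>\<^sub>r T))"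
proof (intro conjI allI impI; elim conjE)
  fix A :: "('q, 'g, 'a, 'b) vpt"
  assume A: "is_vpt \<Sigma>\<^sub>c \<Sigma>\<^sub>r \<Delta> A" "\<not> accepts (vpt_rel A) []"
  obtain T :: "(nat, 'a \<times> 'a, 'b) h2s" where T: "is_h2s (\<Sigma>\<^sub>c \<times> \<Sigma>\<^sub>r) \<Delta> T" "tail_recursive T"
    "h2s_rel T = h2s_rel (h2s_of_vpt A)"
    using ex_nat_h2s[OF is_h2s_h2s_of_vpt[OF A(1)] tail_recursive_h2s_of_vpt] .
  have eq: "vpt_rel A = comp_hedge \<Sigma>\<^sub>c \<Sigma>\<^sub>r T"
    using vpt_rel_eq_comp_hedge_h2s_of_vpt[OF assms(1) A(1)] T(3) by (simp add: comp_hedge_def)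
  \<comment> \<open>The empty word is sent to the empty hedge, so the equality of relations
    transfers non-acceptance.\<close>
  with A(2) have "\<not> accepts (h2s_rel T) []"
    using accepts_comp_hedge_Nil[OF assms(1)] by metis
  with T eq show "\<exists>T :: (nat, 'a \<times> 'a, 'b) h2s.
      is_h2s (\<Sigma>\<^sub>c \<times> \<Sigma>\<^sub>r) \<Delta> T \<and> tail_recursive T \<and> \<not> accepts (h2s_rel T) [] \<and>
      vpt_rel A = comp_hedge \<Sigma>\<^sub>c \<Sigma>\<^sub>r T"
    by blast
next
  fix T :: "('p, 'a \<times> 'a, 'b) h2s"
  assume T: "is_h2s (\<Sigma>\<^sub>c \<times> \<Sigma>\<^sub>r) \<Delta> T" "tail_recursive T" "\<not> accepts (h2s_rel T) []"
  \<comment> \<open>\<open>vpt_of_h2s\<close> keeps the states, so renaming them beforehand already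
    yields an automaton over \<open>nat\<close>. A second injection \<open>g\<close> then codes the
    rules as stack symbols.\<close>
  obtain T' :: "(nat, 'a \<times> 'a, 'b) h2s" where T': "is_h2s (\<Sigma>\<^sub>c \<times> \<Sigma>\<^sub>r) \<Delta> T'" "tail_recursive T'"
    "h2s_rel T' = h2s_rel T"
    using ex_nat_h2s[OF T(1,2)] .
  have "finite (rules T')"
    using T'(1) by (simp add: is_h2s_def)
  then obtain g :: "_ \<Rightarrow> nat" where g: "inj_on g (rules T')"
    using finite_imp_inj_to_nat_seg by blast
  have eq: "vpt_rel (vpt_of_h2s g T') = comp_hedge \<Sigma>\<^sub>c \<Sigma>\<^sub>r T"
    using vpt_rel_vpt_of_h2s[OF assms(1) T'(1,2) g] T'(3) by (simp add: comp_hedge_def)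
  with T(3) have "\<not> accepts (vpt_rel (vpt_of_h2s g T')) []"
    using accepts_comp_hedge_Nil[OF assms(1)] by metis
  with eq is_vpt_vpt_of_h2s[OF T'(1)] show "\<exists>A :: (nat, nat, 'a, 'b) vpt.
      is_vpt \<Sigma>\<^sub>c \<Sigma>\<^sub>r \<Delta> A \<and> \<not> accepts (vpt_rel A) [] \<and> vpt_rel A = comp_hedge \<Sigma>\<^sub>c \<Sigma>\<^sub>r T"
    by blast
qed

end
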